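(* Let $\tau$ be a vocabulary with $\aleph_0$ constants and let $T$ be a first-order $\tau$-theory such that, for any model of $T$, the substructure consisting of the elements named by these constants is a model of $T$. Then no model of $T^{\omega}$ has a proper extension (that is a model of $T^\omega$).
   Context: $T^\omega$ denotes the set of consequences of $T$ in inferential $\omega$-logic, whose models are the structures carrying an admissible valuation. Inferential $\omega$-logic: classical first-order natural deduction extended by, for any countable set $C$ of constants containing $\mathrm{Const}(\tau)$ and any formula $\phi(x,\bar d)$ with parameters from $C$: $I$-$\omega$-rule: from $\{\phi(c,\bar d):c\in\mathrm{Const}(\tau)\}$ infer $(\forall x)\phi(x,\bar d)$; $I$-$\forall E$: from $(\forall x)\phi(x,\bar d)$ infer $\phi(e,\bar d)$ for each $e\in C$; plus matching existential rules. A valuation (Robinson semantics, with constants from $C$ naming elements) is admissible if it assigns consistent truth values to all quantifier-free sentences respecting the identity rules, and every rule instance with true premises has a true conclusion. *)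

theory Defs
  imports Main "HOL-Library.Countable_Set"
begin

section \<open>First-order syntax and Tarski semantics\<close>

text \<open>The symbols of a vocabulary are subsets of the types, so that a vocabulary
  may have no function or no relation symbols at all.\<close>

record ('c, 'f, 'r) vocab =
  Consts :: "'c set"
  Funs :: "'f set"
  Rels :: "'r set"
  farity :: "'f \<Rightarrow> nat"
  rarity :: "'r \<Rightarrow> nat"

text \<open>Nullary function symbols are excluded: otherwise there would be constants
  outside \<open>Consts\<close>.\<close>

definition is_vocab :: "('c, 'f, 'r) vocab \<Rightarrow> bool" where
  "is_vocab \<tau> \<longleftrightarrow> (\<forall>f\<in>Funs \<tau>. farity \<tau> f > 0)"

datatype ('c, 'f) trm = Var nat | Cst 'c | Fn 'f "('c, 'f) trm list"

text \<open>Variables are de Bruijn indices. In the scope of \<open>Uni\<close> or \<open>Exi\<close> index \<open>0\<close>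
  is the quantified variable.\<close>

datatype ('c, 'f, 'r) fm =
    Eq "('c, 'f) trm" "('c, 'f) trm"
  | Rel 'r "('c, 'f) trm list"
  | Neg "('c, 'f, 'r) fm"
  | Con "('c, 'f, 'r) fm" "('c, 'f, 'r) fm"
  | Dis "('c, 'f, 'r) fm" "('c, 'f, 'r) fm"
  | Imp "('c, 'f, 'r) fm" "('c, 'f, 'r) fm"
  | Uni "('c, 'f, 'r) fm"
  | Exi "('c, 'f, 'r) fm"

fun trm_over :: "('c, 'f, 'r) vocab \<Rightarrow> ('c, 'f) trm \<Rightarrow> bool" where
  "trm_over \<tau> (Var n) \<longleftrightarrow> True"
| "trm_over \<tau> (Cst c) \<longleftrightarrow> c \<in> Consts \<tau>"
| "trm_over \<tau> (Fn f ts) \<longleftrightarrow>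
     f \<in> Funs \<tau> \<and> length ts = farity \<tau> f \<and> (\<forall>t\<in>set ts. trm_over \<tau> t)"

primrec fm_over :: "('c, 'f, 'r) vocab \<Rightarrow> ('c, 'f, 'r) fm \<Rightarrow> bool" where
  "fm_over \<tau> (Eq s t) \<longleftrightarrow> trm_over \<tau> s \<and> trm_over \<tau> t"
| "fm_over \<tau> (Rel r ts) \<longleftrightarrow>
     r \<in> Rels \<tau> \<and> length ts = rarity \<tau> r \<and> (\<forall>t\<in>set ts. trm_over \<tau> t)"
| "fm_over \<tau> (Neg \<phi>) \<longleftrightarrow> fm_over \<tau> \<phi>"
| "fm_over \<tau> (Con \<phi> \<psi>) \<longleftrightarrow> fm_over \<tau> \<phi> \<and> fm_over \<tau> \<psi>"
| "fm_over \<tau> (Dis \<phi> \<psi>) \<longleftrightarrow> fm_over \<tau> \<phi> \<and> fm_over \<tau> \<psi>"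
| "fm_over \<tau> (Imp \<phi> \<psi>) \<longleftrightarrow> fm_over \<tau> \<phi> \<and> fm_over \<tau> \<psi>"
| "fm_over \<tau> (Uni \<phi>) \<longleftrightarrow> fm_over \<tau> \<phi>"
| "fm_over \<tau> (Exi \<phi>) \<longleftrightarrow> fm_over \<tau> \<phi>"

text \<open>All free variables are below \<open>n\<close>.\<close>

fun trm_below :: "nat \<Rightarrow> ('c, 'f) trm \<Rightarrow> bool" where
  "trm_below n (Var k) \<longleftrightarrow> k < n"
| "trm_below n (Cst c) \<longleftrightarrow> True"
| "trm_below n (Fn f ts) \<longleftrightarrow> (\<forall>t\<in>set ts. trm_below n t)"

fun fm_below :: "nat \<Rightarrow> ('c, 'f, 'r) fm \<Rightarrow> bool" where
  "fm_below n (Eq s t) \<longleftrightarrow> trm_below n s \<and> trm_below n t"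
| "fm_below n (Rel r ts) \<longleftrightarrow> (\<forall>t\<in>set ts. trm_below n t)"
| "fm_below n (Neg \<phi>) \<longleftrightarrow> fm_below n \<phi>"
| "fm_below n (Con \<phi> \<psi>) \<longleftrightarrow> fm_below n \<phi> \<and> fm_below n \<psi>"
| "fm_below n (Dis \<phi> \<psi>) \<longleftrightarrow> fm_below n \<phi> \<and> fm_below n \<psi>"
| "fm_below n (Imp \<phi> \<psi>) \<longleftrightarrow> fm_below n \<phi> \<and> fm_below n \<psi>"
| "fm_below n (Uni \<phi>) \<longleftrightarrow> fm_below (Suc n) \<phi>"
| "fm_below n (Exi \<phi>) \<longleftrightarrow> fm_below (Suc n) \<phi>"

definition sentences :: "('c, 'f, 'r) vocab \<Rightarrow> ('c, 'f, 'r) fm set" where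
  "sentences \<tau> = {\<phi>. fm_over \<tau> \<phi> \<and> fm_below 0 \<phi>}"

fun atomic :: "('c, 'f, 'r) fm \<Rightarrow> bool" where
  "atomic (Eq s t) \<longleftrightarrow> True"
| "atomic (Rel r ts) \<longleftrightarrow> True"
| "atomic _ \<longleftrightarrow> False"

primrec quantifier_free :: "('c, 'f, 'r) fm \<Rightarrow> bool" where
  "quantifier_free (Eq s t) \<longleftrightarrow> True"
| "quantifier_free (Rel r ts) \<longleftrightarrow> True"
| "quantifier_free (Neg \<phi>) \<longleftrightarrow> quantifier_free \<phi>"
| "quantifier_free (Con \<phi> \<psi>) \<longleftrightarrow> quantifier_free \<phi> \<and> quantifier_free \<psi>"
| "quantifier_free (Dis \<phi> \<psi>) \<longleftrightarrow> quantifier_free \<phi> \<and> quantifier_free \<psi>"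
| "quantifier_free (Imp \<phi> \<psi>) \<longleftrightarrow> quantifier_free \<phi> \<and> quantifier_free \<psi>"
| "quantifier_free (Uni \<phi>) \<longleftrightarrow> False"
| "quantifier_free (Exi \<phi>) \<longleftrightarrow> False"

primrec subst_trm :: "(nat \<Rightarrow> ('c, 'f) trm) \<Rightarrow> ('c, 'f) trm \<Rightarrow> ('c, 'f) trm" where
  "subst_trm \<sigma> (Var n) = \<sigma> n"
| "subst_trm \<sigma> (Cst c) = Cst c"
| "subst_trm \<sigma> (Fn f ts) = Fn f (map (subst_trm \<sigma>) ts)"

definition under_binder :: "(nat \<Rightarrow> ('c, 'f) trm) \<Rightarrow> nat \<Rightarrow> ('c, 'f) trm" where
  "under_binder \<sigma> = case_nat (Var 0) (\<lambda>n. subst_trm (\<lambda>k. Var (Suc k)) (\<sigma> n))"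

fun subst :: "(nat \<Rightarrow> ('c, 'f) trm) \<Rightarrow> ('c, 'f, 'r) fm \<Rightarrow> ('c, 'f, 'r) fm" where
  "subst \<sigma> (Eq s t) = Eq (subst_trm \<sigma> s) (subst_trm \<sigma> t)"
| "subst \<sigma> (Rel r ts) = Rel r (map (subst_trm \<sigma>) ts)"
| "subst \<sigma> (Neg \<phi>) = Neg (subst \<sigma> \<phi>)"
| "subst \<sigma> (Con \<phi> \<psi>) = Con (subst \<sigma> \<phi>) (subst \<sigma> \<psi>)"
| "subst \<sigma> (Dis \<phi> \<psi>) = Dis (subst \<sigma> \<phi>) (subst \<sigma> \<psi>)"
| "subst \<sigma> (Imp \<phi> \<psi>) = Imp (subst \<sigma> \<phi>) (subst \<sigma> \<psi>)"
| "subst \<sigma> (Uni \<phi>) = Uni (subst (under_binder \<sigma>) \<phi>)"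
| "subst \<sigma> (Exi \<phi>) = Exi (subst (under_binder \<sigma>) \<phi>)"

text \<open>\<open>inst t \<phi>\<close> is \<open>\<phi>(t)\<close>, where \<open>\<phi>(x)\<close> is the body of a quantified formula;
  \<open>lift \<phi>\<close> is \<open>\<phi>\<close> with its free variables renamed away from a fresh variable \<open>0\<close>.\<close>

definition inst :: "('c, 'f) trm \<Rightarrow> ('c, 'f, 'r) fm \<Rightarrow> ('c, 'f, 'r) fm" where
  "inst t = subst (case_nat t Var)"

definition lift :: "('c, 'f, 'r) fm \<Rightarrow> ('c, 'f, 'r) fm" where
  "lift = subst (\<lambda>n. Var (Suc n))"

record ('a, 'c, 'f, 'r) struct =
  Dom :: "'a set"
  Cint :: "'c \<Rightarrow> 'a"
  Fint :: "'f \<Rightarrow> 'a list \<Rightarrow> 'a"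
  Rint :: "'r \<Rightarrow> 'a list \<Rightarrow> bool"

definition is_struct :: "('c, 'f, 'r) vocab \<Rightarrow> ('a, 'c, 'f, 'r) struct \<Rightarrow> bool" where
  "is_struct \<tau> M \<longleftrightarrow>
     Dom M \<noteq> {} \<and>
     (\<forall>c\<in>Consts \<tau>. Cint M c \<in> Dom M) \<and>
     (\<forall>f\<in>Funs \<tau>. \<forall>as. set as \<subseteq> Dom M \<and> length as = farity \<tau> f \<longrightarrow> Fint M f as \<in> Dom M)"

primrec val :: "('a, 'c, 'f, 'r) struct \<Rightarrow> (nat \<Rightarrow> 'a) \<Rightarrow> ('c, 'f) trm \<Rightarrow> 'a" where
  "val M e (Var n) = e n"
| "val M e (Cst c) = Cint M c"
| "val M e (Fn f ts) = Fint M f (map (val M e) ts)"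

fun sat :: "('a, 'c, 'f, 'r) struct \<Rightarrow> (nat \<Rightarrow> 'a) \<Rightarrow> ('c, 'f, 'r) fm \<Rightarrow> bool" where
  "sat M e (Eq s t) \<longleftrightarrow> val M e s = val M e t"
| "sat M e (Rel r ts) \<longleftrightarrow> Rint M r (map (val M e) ts)"
| "sat M e (Neg \<phi>) \<longleftrightarrow> \<not> sat M e \<phi>"
| "sat M e (Con \<phi> \<psi>) \<longleftrightarrow> sat M e \<phi> \<and> sat M e \<psi>"
| "sat M e (Dis \<phi> \<psi>) \<longleftrightarrow> sat M e \<phi> \<or> sat M e \<psi>"
| "sat M e (Imp \<phi> \<psi>) \<longleftrightarrow> (sat M e \<phi> \<longrightarrow> sat M e \<psi>)"
| "sat M e (Uni \<phi>) \<longleftrightarrow> (\<forall>a\<in>Dom M. sat M (case_nat a e) \<phi>)"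
| "sat M e (Exi \<phi>) \<longleftrightarrow> (\<exists>a\<in>Dom M. sat M (case_nat a e) \<phi>)"

definition true_in :: "('a, 'c, 'f, 'r) struct \<Rightarrow> ('c, 'f, 'r) fm \<Rightarrow> bool" where
  "true_in M \<phi> \<longleftrightarrow> (\<forall>e. range e \<subseteq> Dom M \<longrightarrow> sat M e \<phi>)"

definition is_model ::
  "('c, 'f, 'r) vocab \<Rightarrow> ('c, 'f, 'r) fm set \<Rightarrow> ('a, 'c, 'f, 'r) struct \<Rightarrow> bool" where
  "is_model \<tau> T M \<longleftrightarrow> is_struct \<tau> M \<and> (\<forall>\<phi>\<in>T. true_in M \<phi>)"

definition substructure ::
  "('c, 'f, 'r) vocab \<Rightarrow> ('a, 'c, 'f, 'r) struct \<Rightarrow> ('a, 'c, 'f, 'r) struct \<Rightarrow> bool" where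
  "substructure \<tau> M N \<longleftrightarrow>
     is_struct \<tau> M \<and> is_struct \<tau> N \<and> Dom M \<subseteq> Dom N \<and>
     (\<forall>c\<in>Consts \<tau>. Cint M c = Cint N c) \<and>
     (\<forall>f\<in>Funs \<tau>. \<forall>as. set as \<subseteq> Dom M \<and> length as = farity \<tau> f \<longrightarrow> Fint M f as = Fint N f as) \<and>
     (\<forall>r\<in>Rels \<tau>. \<forall>as. set as \<subseteq> Dom M \<and> length as = rarity \<tau> r \<longrightarrow> Rint M r as = Rint N r as)"

definition proper_extension ::
  "('c, 'f, 'r) vocab \<Rightarrow> ('a, 'c, 'f, 'r) struct \<Rightarrow> ('a, 'c, 'f, 'r) struct \<Rightarrow> bool" where
  "proper_extension \<tau> N M \<longleftrightarrow> substructure \<tau> M N \<and> Dom M \<noteq> Dom N"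

text \<open>The restriction of \<open>M\<close> to the elements named by constants. If \<open>M\<close> is a structure,
  this is a structure (equivalently, a substructure of \<open>M\<close>) iff the set of named elements
  is nonempty and closed under the functions of \<open>M\<close>. Note that \<open>is_model\<close> requires this.\<close>

definition named_part ::
  "('c, 'f, 'r) vocab \<Rightarrow> ('a, 'c, 'f, 'r) struct \<Rightarrow> ('a, 'c, 'f, 'r) struct" where
  "named_part \<tau> M = M\<lparr>Dom := Cint M ` Consts \<tau>\<rparr>"


section \<open>Inferential \<open>\<omega>\<close>-logic\<close>

text \<open>A set \<open>C\<close> of constants containing the constants of \<open>\<tau>\<close> is given by a set \<open>P\<close> of
  additional constants: \<open>C = Consts (with_params \<tau> P)\<close>. When \<open>\<tau>\<close> has countably many
  constants, \<open>C\<close> is countable iff \<open>P\<close> is.\<close>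

datatype ('c, 'p) cst = Sym 'c | Par 'p

definition with_params :: "('c, 'f, 'r) vocab \<Rightarrow> 'p set \<Rightarrow> (('c, 'p) cst, 'f, 'r) vocab" where
  "with_params \<tau> P =
     \<lparr>Consts = Sym ` Consts \<tau> \<union> Par ` P, Funs = Funs \<tau>, Rels = Rels \<tau>,
      farity = farity \<tau>, rarity = rarity \<tau>\<rparr>"

definition emb :: "('c, 'f, 'r) fm \<Rightarrow> (('c, 'p) cst, 'f, 'r) fm" where
  "emb = map_fm Sym id id"

text \<open>A sequent \<open>(\<Gamma>, \<phi>)\<close> records a conclusion together with its open assumptions.
  In \<open>rule K C S s\<close> the set \<open>S\<close> contains the premises and \<open>s\<close> is the conclusion; \<open>K\<close> is the set
  of constants of the vocabulary and \<open>C\<close> the set of all constants.\<close>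

type_synonym ('c, 'f, 'r) sequent = "('c, 'f, 'r) fm set \<times> ('c, 'f, 'r) fm"

inductive rule ::
  "'c set \<Rightarrow> 'c set \<Rightarrow> ('c, 'f, 'r) sequent set \<Rightarrow> ('c, 'f, 'r) sequent \<Rightarrow> bool"
  for K C :: "'c set" where
  Assm: "\<phi> \<in> \<Gamma> \<Longrightarrow> rule K C {} (\<Gamma>, \<phi>)"
| NegI: "rule K C {(insert \<phi> \<Gamma>, \<psi>), (insert \<phi> \<Gamma>, Neg \<psi>)} (\<Gamma>, Neg \<phi>)"
| NegE: "rule K C {(\<Gamma>, \<phi>), (\<Gamma>, Neg \<phi>)} (\<Gamma>, \<psi>)"
| NegNegE: "rule K C {(\<Gamma>, Neg (Neg \<phi>))} (\<Gamma>, \<phi>)"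
| ConI: "rule K C {(\<Gamma>, \<phi>), (\<Gamma>, \<psi>)} (\<Gamma>, Con \<phi> \<psi>)"
| ConE1: "rule K C {(\<Gamma>, Con \<phi> \<psi>)} (\<Gamma>, \<phi>)"
| ConE2: "rule K C {(\<Gamma>, Con \<phi> \<psi>)} (\<Gamma>, \<psi>)"
| DisI1: "rule K C {(\<Gamma>, \<phi>)} (\<Gamma>, Dis \<phi> \<psi>)"
| DisI2: "rule K C {(\<Gamma>, \<psi>)} (\<Gamma>, Dis \<phi> \<psi>)"
| DisE: "rule K C {(\<Gamma>, Dis \<phi> \<psi>), (insert \<phi> \<Gamma>, \<chi>), (insert \<psi> \<Gamma>, \<chi>)} (\<Gamma>, \<chi>)"
| ImpI: "rule K C {(insert \<phi> \<Gamma>, \<psi>)} (\<Gamma>, Imp \<phi> \<psi>)"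
| ImpE: "rule K C {(\<Gamma>, Imp \<phi> \<psi>), (\<Gamma>, \<phi>)} (\<Gamma>, \<psi>)"
| EqI: "rule K C {} (\<Gamma>, Eq t t)"
| EqE: "rule K C {(\<Gamma>, Eq s t), (\<Gamma>, inst s \<phi>)} (\<Gamma>, inst t \<phi>)"
| AllI: "rule K C {(lift ` \<Gamma>, \<phi>)} (\<Gamma>, Uni \<phi>)"
| AllE: "rule K C {(\<Gamma>, Uni \<phi>)} (\<Gamma>, inst t \<phi>)"
| ExI: "rule K C {(\<Gamma>, inst t \<phi>)} (\<Gamma>, Exi \<phi>)"
| ExE: "rule K C {(\<Gamma>, Exi \<phi>), (insert \<phi> (lift ` \<Gamma>), lift \<chi>)} (\<Gamma>, \<chi>)"
| I_omega: "fm_below 1 \<phi> \<Longrightarrow> rule K C {(\<Gamma>, inst (Cst c) \<phi>) | c. c \<in> K} (\<Gamma>, Uni \<phi>)"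
| I_AllE: "fm_below 1 \<phi> \<Longrightarrow> d \<in> C \<Longrightarrow> rule K C {(\<Gamma>, Uni \<phi>)} (\<Gamma>, inst (Cst d) \<phi>)"
| I_ExI: "fm_below 1 \<phi> \<Longrightarrow> d \<in> C \<Longrightarrow> rule K C {(\<Gamma>, inst (Cst d) \<phi>)} (\<Gamma>, Exi \<phi>)"
| I_ExE: "fm_below 1 \<phi> \<Longrightarrow>
    rule K C (insert (\<Gamma>, Exi \<phi>) {(insert (inst (Cst c) \<phi>) \<Gamma>, \<chi>) | c. c \<in> K}) (\<Gamma>, \<chi>)"

definition rule_instance ::
  "('c, 'f, 'r) vocab \<Rightarrow> 'p set \<Rightarrow> (('c, 'p) cst, 'f, 'r) sequent set \<Rightarrow>
   (('c, 'p) cst, 'f, 'r) sequent \<Rightarrow> bool" where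
  "rule_instance \<tau> P S s \<longleftrightarrow>
     rule (Sym ` Consts \<tau>) (Consts (with_params \<tau> P)) S s \<and>
     (\<forall>(\<Gamma>, \<phi>)\<in>insert s S. \<forall>\<psi>\<in>insert \<phi> \<Gamma>. fm_over (with_params \<tau> P) \<psi>)"

inductive derivable ::
  "('c, 'f, 'r) vocab \<Rightarrow> 'p set \<Rightarrow> (('c, 'p) cst, 'f, 'r) sequent \<Rightarrow> bool"
  for \<tau> :: "('c, 'f, 'r) vocab" and P :: "'p set" where
  "rule_instance \<tau> P S s \<Longrightarrow> (\<And>s'. s' \<in> S \<Longrightarrow> derivable \<tau> P s') \<Longrightarrow> derivable \<tau> P s"

text \<open>\<open>T\<^sup>\<omega>\<close>. Every countable set of additional constants is, up to renaming,
  a set of natural numbers.\<close>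

definition omega_consequences ::
  "('c, 'f, 'r) vocab \<Rightarrow> ('c, 'f, 'r) fm set \<Rightarrow> ('c, 'f, 'r) fm set" where
  "omega_consequences \<tau> T =
     {\<phi> \<in> sentences \<tau>. \<exists>P :: nat set. derivable \<tau> P (emb ` T, emb \<phi>)}"

text \<open>A valuation assigns truth values to sentences. A sequent is true if, however constants
  from \<open>C\<close> are put for its free variables, truth of the assumptions gives truth of the
  conclusion. Without assumptions and free variables this is just truth of the conclusion.\<close>

definition seq_true ::
  "'c set \<Rightarrow> (('c, 'f, 'r) fm \<Rightarrow> bool) \<Rightarrow> ('c, 'f, 'r) sequent \<Rightarrow> bool" where
  "seq_true C v = (\<lambda>(\<Gamma>, \<phi>). \<forall>\<sigma>. range \<sigma> \<subseteq> C \<longrightarrow>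
     (\<forall>\<psi>\<in>\<Gamma>. v (subst (\<lambda>n. Cst (\<sigma> n)) \<psi>)) \<longrightarrow> v (subst (\<lambda>n. Cst (\<sigma> n)) \<phi>))"

definition qf_consistent ::
  "('c, 'f, 'r) vocab \<Rightarrow> (('c, 'f, 'r) fm \<Rightarrow> bool) \<Rightarrow> bool" where
  "qf_consistent \<tau> v \<longleftrightarrow>
     (\<forall>\<phi>\<in>sentences \<tau>. quantifier_free \<phi> \<longrightarrow> v (Neg \<phi>) = (\<not> v \<phi>)) \<and>
     (\<forall>\<phi>\<in>sentences \<tau>. \<forall>\<psi>\<in>sentences \<tau>. quantifier_free \<phi> \<and> quantifier_free \<psi> \<longrightarrow>
        v (Con \<phi> \<psi>) = (v \<phi> \<and> v \<psi>) \<and>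
        v (Dis \<phi> \<psi>) = (v \<phi> \<or> v \<psi>) \<and>
        v (Imp \<phi> \<psi>) = (v \<phi> \<longrightarrow> v \<psi>)) \<and>
     (\<forall>t. trm_over \<tau> t \<and> trm_below 0 t \<longrightarrow> v (Eq t t)) \<and>
     (\<forall>s t \<phi>. trm_over \<tau> s \<and> trm_below 0 s \<and> trm_over \<tau> t \<and> trm_below 0 t \<and>
        fm_over \<tau> \<phi> \<and> fm_below 1 \<phi> \<and> quantifier_free \<phi> \<and> v (Eq s t) \<and> v (inst s \<phi>) \<longrightarrow>
        v (inst t \<phi>))"

definition admissible ::
  "('c, 'f, 'r) vocab \<Rightarrow> 'p set \<Rightarrow> ((('c, 'p) cst, 'f, 'r) fm \<Rightarrow> bool) \<Rightarrow> bool" where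
  "admissible \<tau> P v \<longleftrightarrow>
     qf_consistent (with_params \<tau> P) v \<and>
     (\<forall>S s. rule_instance \<tau> P S s \<longrightarrow>
        (\<forall>s'\<in>S. seq_true (Consts (with_params \<tau> P)) v s') \<longrightarrow>
        seq_true (Consts (with_params \<tau> P)) v s)"

text \<open>In Robinson semantics each element \<open>a\<close> of \<open>M\<close> has the name \<open>Par a\<close>.\<close>

definition with_names :: "('a, 'c, 'f, 'r) struct \<Rightarrow> ('a, ('c, 'a) cst, 'f, 'r) struct" where
  "with_names M =
     \<lparr>Dom = Dom M, Cint = case_cst (Cint M) (\<lambda>a. a), Fint = Fint M, Rint = Rint M\<rparr>"

text \<open>A structure carries the valuation \<open>v\<close> of the sentences with parameters in \<open>M\<close> if \<open>v\<close> is
  correct about atomic sentences; the values of the other sentences are constrained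
  by admissibility only, which is required for each countable set of constants.\<close>

definition carries_admissible ::
  "('c, 'f, 'r) vocab \<Rightarrow> ('a, 'c, 'f, 'r) struct \<Rightarrow> ((('c, 'a) cst, 'f, 'r) fm \<Rightarrow> bool) \<Rightarrow> bool" where
  "carries_admissible \<tau> M v \<longleftrightarrow>
     (\<forall>\<phi>\<in>sentences (with_params \<tau> (Dom M)). atomic \<phi> \<longrightarrow> v \<phi> = true_in (with_names M) \<phi>) \<and>
     (\<forall>P. P \<subseteq> Dom M \<and> countable P \<longrightarrow> admissible \<tau> P v)"

definition is_omega_model ::
  "('c, 'f, 'r) vocab \<Rightarrow> ('c, 'f, 'r) fm set \<Rightarrow> ('a, 'c, 'f, 'r) struct \<Rightarrow> bool" where
  "is_omega_model \<tau> S M \<longleftrightarrow>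
     is_struct \<tau> M \<and> (\<exists>v. carries_admissible \<tau> M v \<and> (\<forall>\<phi>\<in>S. v (emb \<phi>)))"

end

theory Submission
  imports Defs
begin

text \<open>An element \<open>d\<close> of a model not named by a constant would satisfy \<open>c \<noteq> d\<close> for every
  constant \<open>c\<close>. The \<open>\<omega>\<close>-rule admits \<open>d\<close> as a parameter, so it yields \<open>\<forall>x. x \<noteq> d\<close>, whose
  instance at \<open>d\<close> is \<open>d \<noteq> d\<close>. So all elements of a model are named, and hence belong to
  every substructure.\<close>

lemma carries_admissible_named:
  fixes M :: "('a, 'c, 'f, 'r) struct"
  assumes carries: "carries_admissible \<tau> M v" and d: "d \<in> Dom M"
  shows "d \<in> Cint M ` Consts \<tau>"
proof (rule ccontr)
  assume unnamed: "d \<notin> Cint M ` Consts \<tau>"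
  define C where "C = Consts (with_params \<tau> {d})"
  have Pd: "Par d \<in> C"
    by (simp add: C_def with_params_def)
  \<comment> \<open>The singleton \<open>{d}\<close> is a countable set of parameters, so
    admissibility applies with \<open>d\<close> as the only added constant.\<close>
  have adm: "admissible \<tau> {d} v"
    using carries d by (simp add: carries_admissible_def)
  have step: "seq_true C v s"
    if "rule_instance \<tau> {d} S s" and "\<And>s'. s' \<in> S \<Longrightarrow> seq_true C v s'" for S s
    using adm that unfolding admissible_def C_def by blast
  \<comment> \<open>The structure fixes \<open>v\<close> on atomic sentences only; inequalities get
    their values through Boolean consistency.\<close>
  have qf_neg: "v (Neg (Eq (Cst k) (Cst (Par d)))) = (\<not> v (Eq (Cst k) (Cst (Par d))))"
    if "k \<in> C" for k
    using adm that Pd by (simp add: admissible_def qf_consistent_def sentences_def C_def)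
  have atom: "v (Eq (Cst (Sym c)) (Cst (Par d))) = (Cint M c = d)" if "c \<in> Consts \<tau>" for c
  proof -
    have "v (Eq (Cst (Sym c)) (Cst (Par d))) =
        true_in (with_names M) (Eq (Cst (Sym c)) (Cst (Par d)))"
      using carries that d by (simp add: carries_admissible_def sentences_def with_params_def)
    \<comment> \<open>The constant assignment at \<open>d\<close> keeps \<open>true_in\<close> from
      holding vacuously.\<close>
    also have "\<dots> = (Cint M c = d)"
      using d by (auto simp: true_in_def with_names_def intro: exI[of _ "\<lambda>_. d"])
    finally show ?thesis .
  qed
  define \<phi> :: "(('c, 'a) cst, 'f, 'r) fm" where "\<phi> = Neg (Eq (Var 0) (Cst (Par d)))"
  have below: "fm_below 1 \<phi>" by (simp add: \<phi>_def)
  have inst: "inst (Cst k) \<phi> = Neg (Eq (Cst k) (Cst (Par d)))" for k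
    by (simp add: \<phi>_def inst_def)
  \<comment> \<open>The premises run over the constants of \<tau> only: \<open>d\<close> occurs in
    \<phi>, but no premise says \<open>d \<noteq> d\<close>.\<close>
  let ?S = "{({}, inst (Cst k) \<phi>) | k. k \<in> Sym ` Consts \<tau>}
    :: (('c, 'a) cst, 'f, 'r) sequent set"
  have "seq_true C v ({}, Uni \<phi>)"
  proof (rule step)
    show "rule_instance \<tau> {d} ?S ({}, Uni \<phi>)"
      unfolding rule_instance_def
      using rule.I_omega[OF below, of "Sym ` Consts \<tau>" C "{}"]
      by (auto simp: inst) (auto simp: \<phi>_def C_def with_params_def)
  next
    fix s' assume "s' \<in> ?S"
    then obtain c where c: "c \<in> Consts \<tau>" and s': "s' = ({}, inst (Cst (Sym c)) \<phi>)"
      by auto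
    have "v (inst (Cst (Sym c)) \<phi>)"
      using qf_neg[of "Sym c"] atom[OF c] unnamed c
      by (auto simp: inst C_def with_params_def)
    then show "seq_true C v s'"
      by (simp add: s' seq_true_def inst)
  qed
  \<comment> \<open>Elimination, unlike the \<omega>-rule, ranges over all of \<open>C\<close>,
    hence reaches \<open>Par d\<close>.\<close>
  moreover have "rule_instance \<tau> {d} {({}, Uni \<phi>)} ({}, inst (Cst (Par d)) \<phi>)"
    using rule.I_AllE[OF below Pd, of "Sym ` Consts \<tau>" "{}"] Pd
    by (auto simp: rule_instance_def inst_def \<phi>_def C_def)
  ultimately have "seq_true C v ({}, inst (Cst (Par d)) \<phi>)"
    by (blast intro: step)
  \<comment> \<open>Substitution leaves the closed conclusion unchanged, but \<open>seq_true\<close>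
    yields its truth only if some substitution into \<open>C\<close> exists.\<close>
  moreover have "\<exists>\<sigma> :: nat \<Rightarrow> _. range \<sigma> \<subseteq> C"
    using Pd by (intro exI[of _ "\<lambda>_. Par d"]) auto
  ultimately have "v (Neg (Eq (Cst (Par d)) (Cst (Par d))))"
    by (auto simp: seq_true_def inst)
  moreover have "v (Eq (Cst (Par d)) (Cst (Par d)))"
    using adm Pd by (simp add: admissible_def qf_consistent_def C_def)
  ultimately show False
    using qf_neg[OF Pd] by simp
qed

theorem theorem4p1p12:
  fixes \<tau> :: "('c, 'f, 'r) vocab" and T :: "('c, 'f, 'r) fm set"
  assumes "is_vocab \<tau>"
    and "countable (Consts \<tau>)" and "infinite (Consts \<tau>)"
    and "T \<subseteq> sentences \<tau>"
    and "\<And>M :: ('a, 'c, 'f, 'r) struct. is_model \<tau> T M \<Longrightarrow> is_model \<tau> T (named_part \<tau> M)"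
  shows "\<not> (\<exists>M N :: ('a, 'c, 'f, 'r) struct.
            is_omega_model \<tau> (omega_consequences \<tau> T) M \<and>
            is_omega_model \<tau> (omega_consequences \<tau> T) N \<and>
            proper_extension \<tau> N M)"
proof
  assume "\<exists>M N :: ('a, 'c, 'f, 'r) struct.
            is_omega_model \<tau> (omega_consequences \<tau> T) M \<and>
            is_omega_model \<tau> (omega_consequences \<tau> T) N \<and>
            proper_extension \<tau> N M"
  then obtain M N :: "('a, 'c, 'f, 'r) struct" and v where
    N: "carries_admissible \<tau> N v" and sub: "substructure \<tau> M N" and ne: "Dom M \<noteq> Dom N"
    unfolding is_omega_model_def proper_extension_def by blast
  have "Dom N \<subseteq> Cint N ` Consts \<tau>"
    using carries_admissible_named[OF N] by blast
  \<comment> \<open>A substructure contains the values of all constants, and these agree with those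
    in \<open>N\<close>.\<close>
  also have "\<dots> \<subseteq> Dom M"
    using sub by (force simp: substructure_def is_struct_def)
  finally show False
    using sub ne by (auto simp: substructure_def)
qed

end
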